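(* For a reduced commutative ring $R$ with identity, the following statements are equivalent: (1) $\chi(\mathbb{AG}(R))$ is finite. (2) $cl(\mathbb{AG}(R))$ is finite. (3) $\mathbb{AG}(R)$ does not have an infinite clique. (4) $R$ has a finite number of minimal prime ideals.
   Context: An ideal $I$ of $R$ is an annihilating-ideal if $\mathrm{Ann}(I)\neq(0)$, i.e. there is a nonzero ideal $J$ of $R$ with $IJ=(0)$. The annihilating-ideal graph $\mathbb{AG}(R)$ is the undirected simple graph whose vertices are the nonzero annihilating-ideals of $R$, where two distinct vertices $I,J$ are adjacent if and only if $IJ=(0)$. For a graph $G$, $\chi(G)$ is the chromatic number and $cl(G)$ is the clique number (number of vertices in a largest complete subgraph; infinite if the sizes of complete subgraphs are not bounded by a finite number). An infinite clique is a complete subgraph with infinitely many vertices. *)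

theory Defs
  imports
    "HOL-Algebra.Ideal_Product"
    "HOL-Library.Ramsey"
    "HOL-Library.Extended_Nat"
begin

section \<open>Graphs\<close>

text \<open>A simple graph is a vertex set \<open>V\<close> with a set \<open>E\<close> of two-element subsets of \<open>V\<close>, the
  representation used by \<^const>\<open>clique\<close>. Only the finiteness of the two numbers below is
  distinguished, so both take values in \<^typ>\<open>enat\<close>: all infinite values are collapsed to \<open>\<infinity>\<close>.\<close>

definition colouring :: "'v set \<Rightarrow> 'v set set \<Rightarrow> nat \<Rightarrow> ('v \<Rightarrow> nat) \<Rightarrow> bool" where
  "colouring V E n c \<longleftrightarrow>
     c ` V \<subseteq> {..<n} \<and> (\<forall>u\<in>V. \<forall>v\<in>V. {u, v} \<in> E \<longrightarrow> c u \<noteq> c v)"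

text \<open>The infimum of the empty set is \<open>\<infinity>\<close>.\<close>

definition chromatic_number :: "'v set \<Rightarrow> 'v set set \<Rightarrow> enat" where
  "chromatic_number V E = (INF n \<in> {n. \<exists>c. colouring V E n c}. enat n)"

text \<open>An infinite clique contains finite cliques of every size, so ranging over the finite
  cliques gives \<open>\<infinity>\<close> exactly when the sizes of complete subgraphs are unbounded.\<close>

definition clique_number :: "'v set \<Rightarrow> 'v set set \<Rightarrow> enat" where
  "clique_number V E = (SUP K \<in> {K. K \<subseteq> V \<and> finite K \<and> clique K E}. enat (card K))"

section \<open>Rings and the annihilating-ideal graph\<close>

definition reduced :: "('a, 'b) ring_scheme \<Rightarrow> bool" where
  "reduced R \<longleftrightarrow> (\<forall>x\<in>carrier R. \<forall>n::nat. x [^]\<^bsub>R\<^esub> n = \<zero>\<^bsub>R\<^esub> \<longrightarrow> x = \<zero>\<^bsub>R\<^esub>)"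

definition minimal_prime :: "('a, 'b) ring_scheme \<Rightarrow> 'a set \<Rightarrow> bool" where
  "minimal_prime R P \<longleftrightarrow> primeideal P R \<and> (\<forall>Q. primeideal Q R \<and> Q \<subseteq> P \<longrightarrow> Q = P)"

definition Ann :: "('a, 'b) ring_scheme \<Rightarrow> 'a set \<Rightarrow> 'a set" where
  "Ann R I = {r \<in> carrier R. \<forall>x\<in>I. r \<otimes>\<^bsub>R\<^esub> x = \<zero>\<^bsub>R\<^esub>}"

definition annihilating_ideal :: "('a, 'b) ring_scheme \<Rightarrow> 'a set \<Rightarrow> bool" where
  "annihilating_ideal R I \<longleftrightarrow> ideal I R \<and> Ann R I \<noteq> {\<zero>\<^bsub>R\<^esub>}"

definition AG_verts :: "('a, 'b) ring_scheme \<Rightarrow> 'a set set" where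
  "AG_verts R = {I. annihilating_ideal R I \<and> I \<noteq> {\<zero>\<^bsub>R\<^esub>}}"

definition AG_edges :: "('a, 'b) ring_scheme \<Rightarrow> 'a set set set" where
  "AG_edges R =
     {{I, J} | I J. I \<in> AG_verts R \<and> J \<in> AG_verts R \<and> I \<noteq> J \<and> I \<cdot>\<^bsub>R\<^esub> J = {\<zero>\<^bsub>R\<^esub>}}"

end

theory Submission
  imports Defs
begin

text \<open>
  In a reduced ring, an element that lies in every minimal prime ideal vanishes. Hence a nonzero
  ideal \<open>I\<close> fails to be contained in some minimal prime, and choosing one such prime as the colour
  of \<open>I\<close> is a proper colouring: if \<open>I J = 0 \<subseteq> P\<close>, then \<open>P\<close> contains \<open>I\<close> or \<open>J\<close>. So finitely many
  minimal primes give a finite chromatic number. The passage from the chromatic number to cliques,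
  and from finite cliques to infinite ones, is general graph theory.

  What remains is to derive the finiteness of the set of minimal primes from the absence of an
  infinite clique. An infinite set of nonzero elements whose pairwise products vanish
  yields an infinite clique of principal ideals, so no such set exists. The primes are found among
  the annihilators \<open>Ann(z)\<close> of single elements.
  \<^item> Every nonzero \<open>y\<close> has a multiple \<open>z \<noteq> 0\<close> with \<open>Ann(z)\<close> prime. Otherwise every nonzero multiple
    of \<open>y\<close> splits off two nonzero multiples with product zero; keeping one of them and splitting
    the other forever produces an infinite orthogonal set. It follows that the prime annihilators
    intersect in zero, as \<open>y z \<noteq> 0\<close> for a nonzero multiple \<open>z\<close> of \<open>y\<close>.
  \<^item> If \<open>Ann(z)\<close> and \<open>Ann(w)\<close> are prime and \<open>z w \<noteq> 0\<close>, then both equal \<open>Ann(z w)\<close>. Distinct prime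
    annihilators thus come from orthogonal elements, so there are only finitely many of them.
  A prime containing a finite intersection of ideals contains one of them. Therefore every minimal
  prime contains, and by minimality is, one of the finitely many prime annihilators.
\<close>

section \<open>Chromatic number, clique number and infinite cliques\<close>

lemma chromatic_number_finite_iff:
  "chromatic_number V E < \<infinity> \<longleftrightarrow> (\<exists>n c. colouring V E n c)"
  unfolding chromatic_number_def INF_less_iff by auto

lemma clique_card_le_colours:
  assumes "colouring V E n c" "K \<subseteq> V" "clique K E"
  shows "card K \<le> n"
proof -
  have "inj_on c K"
    using assms unfolding colouring_def clique_def inj_on_def by blast
  moreover have "c ` K \<subseteq> {..<n}"
    using assms(1,2) unfolding colouring_def by blast
  ultimately show ?thesis
    using card_inj_on_le[of c K "{..<n}"] by simp
qed

lemma clique_number_finite_if_colouring: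
  assumes "colouring V E n c"
  shows "clique_number V E < \<infinity>"
proof -
  have "clique_number V E \<le> enat n"
    unfolding clique_number_def using clique_card_le_colours[OF assms] by (auto intro: SUP_least)
  then show ?thesis
    using enat_ord_simps(4) order.strict_trans1 by blast
qed

lemma no_infinite_clique_if_clique_number_finite:
  assumes "clique_number V E < \<infinity>" "K \<subseteq> V" "clique K E"
  shows "finite K"
proof (rule ccontr)
  assume "infinite K"
  obtain m where m: "clique_number V E = enat m"
    using assms(1) by auto
  obtain L where L: "L \<subseteq> K" "finite L" "card L = Suc m"
    using infinite_arbitrarily_large[OF \<open>infinite K\<close>] by blast
  have "enat (card L) \<le> clique_number V E"
    unfolding clique_number_def using L assms(2,3) by (intro SUP_upper) (auto intro: smaller_clique)
  then show False
    using m L(3) by simp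
qed

context cring
begin

section \<open>Products and annihilators in reduced rings\<close>

lemma reduced_square_nonzero:
  assumes "reduced R" "x \<in> carrier R" "x \<noteq> \<zero>"
  shows "x \<otimes> x \<noteq> \<zero>"
proof
  assume "x \<otimes> x = \<zero>"
  then have "x [^] (2::nat) = \<zero>"
    using assms(2) by (simp add: numeral_2_eq_2)
  then show False
    using assms unfolding reduced_def by blast
qed

lemma ideal_prod_eq_zero_iff:
  assumes "ideal I R" "ideal J R"
  shows "I \<cdot> J = {\<zero>} \<longleftrightarrow> (\<forall>x\<in>I. \<forall>y\<in>J. x \<otimes> y = \<zero>)"
proof
  assume "I \<cdot> J = {\<zero>}"
  then show "\<forall>x\<in>I. \<forall>y\<in>J. x \<otimes> y = \<zero>"
    using ideal_prod.prod[of _ I _ J R] by blast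
next
  assume zero: "\<forall>x\<in>I. \<forall>y\<in>J. x \<otimes> y = \<zero>"
  have "s = \<zero>" if "s \<in> I \<cdot> J" for s
    using that by induction (use zero in auto)
  moreover have "\<zero> \<in> I \<cdot> J"
    using ideal_prod_is_ideal[OF assms] by (simp add: additive_subgroup.zero_closed ideal.axioms(1))
  ultimately show "I \<cdot> J = {\<zero>}"
    by blast
qed

lemma Ann_ideal:
  assumes "z \<in> carrier R"
  shows "ideal (Ann R {z}) R"
proof (rule idealI[OF ring_axioms])
  show "subgroup (Ann R {z}) (add_monoid R)"
    by (rule subgroup.intro) (use assms in \<open>auto simp: Ann_def l_distr l_minus a_inv_def[symmetric]\<close>)
next
  fix a x
  assume ax: "a \<in> Ann R {z}" "x \<in> carrier R"
  then show "x \<otimes> a \<in> Ann R {z}"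
    using assms by (auto simp: Ann_def m_assoc)
  then show "a \<otimes> x \<in> Ann R {z}"
    using ax m_comm[of a x] by (auto simp: Ann_def)
qed

section \<open>Minimal primes of a reduced ring intersect in zero\<close>

text \<open>The complement of a maximal multiplicative set \<open>M\<close> avoiding zero is a minimal prime. Enlarging
  \<open>M\<close> by the powers of some \<open>c \<notin> M\<close> must produce zero, and in a reduced ring this already means that
  \<open>c\<close> is annihilated by an element of \<open>M\<close>; this description makes the complement of \<open>M\<close> an
  ideal. Starting the maximization from the powers of \<open>x\<close> gives a minimal prime without \<open>x\<close>.\<close>

lemma minimal_prime_avoiding:
  assumes red: "reduced R" and x: "x \<in> carrier R" "x \<noteq> \<zero>"
  shows "\<exists>P. minimal_prime R P \<and> x \<notin> P"
proof -
  define \<S> where "\<S> = {S. S \<subseteq> carrier R \<and> x \<in> S \<and> \<one> \<in> S \<and> \<zero> \<notin> S \<and> (\<forall>a\<in>S. \<forall>b\<in>S. a \<otimes> b \<in> S)}"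
  have "range (\<lambda>n::nat. x [^] n) \<in> \<S>"
  proof -
    have "x \<in> range (\<lambda>n::nat. x [^] n)" "\<one> \<in> range (\<lambda>n::nat. x [^] n)"
      using x(1) range_eqI[of x "\<lambda>n::nat. x [^] n" "Suc 0"] range_eqI[of \<one> "\<lambda>n::nat. x [^] n" 0]
      by auto
    moreover have "\<zero> \<notin> range (\<lambda>n::nat. x [^] n)"
      using red x unfolding reduced_def by (metis imageE)
    ultimately show ?thesis
      unfolding \<S>_def using x(1) by (auto simp: nat_pow_mult)
  qed
  moreover have "\<Union>\<C> \<in> \<S>" if "\<C> \<noteq> {}" "subset.chain \<S> \<C>" for \<C>
  proof -
    have sub: "\<C> \<subseteq> \<S>" and tot: "\<And>A B. A \<in> \<C> \<Longrightarrow> B \<in> \<C> \<Longrightarrow> A \<subseteq> B \<or> B \<subseteq> A"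
      using that(2) unfolding subset_chain_def by blast+
    have "a \<otimes> b \<in> \<Union>\<C>" if ab: "a \<in> A" "A \<in> \<C>" "b \<in> B" "B \<in> \<C>" for a b A B
    proof -
      have "\<exists>C\<in>\<C>. a \<in> C \<and> b \<in> C"
        using tot[OF ab(2,4)] ab by blast
      then show ?thesis
        using sub unfolding \<S>_def by blast
    qed
    then show ?thesis
      using sub \<open>\<C> \<noteq> {}\<close> unfolding \<S>_def by blast
  qed
  ultimately obtain M where M: "M \<in> \<S>" and max: "\<And>S. S \<in> \<S> \<Longrightarrow> M \<subseteq> S \<Longrightarrow> S = M"
    using subset_Zorn_nonempty[of \<S>] by blast
  have Mc: "M \<subseteq> carrier R" and Mx: "x \<in> M" and M1: "\<one> \<in> M" and M0: "\<zero> \<notin> M"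
    and Mm: "\<And>a b. a \<in> M \<Longrightarrow> b \<in> M \<Longrightarrow> a \<otimes> b \<in> M"
    using M unfolding \<S>_def by blast+
  have ann: "\<exists>s\<in>M. s \<otimes> c = \<zero>" if c: "c \<in> carrier R" "c \<notin> M" for c
  proof -
    \<comment> \<open>The multiplicative set generated by \<open>M\<close> and \<open>c\<close>.\<close>
    define S where "S = {s \<otimes> c [^] n | s n. s \<in> M \<and> (n::nat) \<in> UNIV}"
    have MS: "M \<subseteq> S"
    proof
      fix s assume "s \<in> M"
      then have "s = s \<otimes> c [^] (0::nat)" using Mc by auto
      with \<open>s \<in> M\<close> show "s \<in> S" unfolding S_def by blast
    qed
    have "c = \<one> \<otimes> c [^] (Suc 0)" using c(1) by simp
    then have "c \<in> S" unfolding S_def using M1 by blast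
    have "a \<otimes> b \<in> S" if ab: "a \<in> S" "b \<in> S" for a b
    proof -
      obtain s m t n where st: "s \<in> M" "t \<in> M"
        and eq: "a = s \<otimes> c [^] (m::nat)" "b = t \<otimes> c [^] (n::nat)"
        using ab unfolding S_def by blast
      have "s \<in> carrier R" "t \<in> carrier R" using st Mc by auto
      then have "a \<otimes> b = (s \<otimes> t) \<otimes> c [^] (m + n)"
        unfolding eq using c(1) by (simp add: nat_pow_mult[symmetric] m_ac)
      then show ?thesis unfolding S_def using Mm[OF st] by blast
    qed
    moreover have "S \<subseteq> carrier R"
      unfolding S_def using Mc c(1) by auto
    moreover have "S \<noteq> M"
      using \<open>c \<in> S\<close> c(2) by blast
    ultimately have "\<zero> \<in> S"
      using max[of S] MS M1 Mx unfolding \<S>_def by blast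
    then obtain s n where s: "s \<in> M" and sn: "s \<otimes> c [^] (n::nat) = \<zero>"
      unfolding S_def by auto
    have sc: "s \<in> carrier R" using s Mc by blast
    \<comment> \<open>The exponent \<open>n + 1\<close> also covers \<open>n = 0\<close>.\<close>
    have "(s \<otimes> c) [^] Suc n = (s [^] n \<otimes> c) \<otimes> (s \<otimes> c [^] n)"
      using sc c(1) by (simp add: nat_pow_distrib m_ac)
    then have "(s \<otimes> c) [^] Suc n = \<zero>"
      using sn sc c(1) by simp
    then have "s \<otimes> c = \<zero>"
      using red sc c(1) unfolding reduced_def by blast
    then show ?thesis using s by blast
  qed
  have notin: "c \<notin> M" if "s \<in> M" "s \<otimes> c = \<zero>" for s c
    using Mm[of s c] that M0 by auto
  define P where "P = carrier R - M"
  have P_iff: "c \<in> P \<longleftrightarrow> c \<in> carrier R \<and> (\<exists>s\<in>M. s \<otimes> c = \<zero>)" for c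
    unfolding P_def using ann notin by blast
  have mult: "y \<otimes> c \<in> P" if c: "c \<in> P" and y: "y \<in> carrier R" for c y
  proof -
    obtain s where s: "s \<in> M" "s \<otimes> c = \<zero>" and cc: "c \<in> carrier R" using c P_iff by blast
    have "s \<otimes> (y \<otimes> c) = y \<otimes> (s \<otimes> c)" using s(1) Mc cc y by (auto simp: m_ac)
    then show ?thesis using s cc y by (auto simp: P_iff)
  qed
  have "ideal P R"
  proof (rule idealI[OF ring_axioms])
    show "subgroup P (add_monoid R)"
    proof (rule subgroup.intro; simp add: a_inv_def[symmetric])
      show "P \<subseteq> carrier R" unfolding P_def by blast
      show "\<zero> \<in> P" unfolding P_def using M0 by simp
      show "a \<oplus> b \<in> P" if ab: "a \<in> P" "b \<in> P" for a b
      proof -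
        obtain s t where st: "s \<in> M" "s \<otimes> a = \<zero>" "t \<in> M" "t \<otimes> b = \<zero>"
          and abc: "a \<in> carrier R" "b \<in> carrier R" using ab P_iff by blast
        have stc: "s \<in> carrier R" "t \<in> carrier R" using st Mc by auto
        have "(s \<otimes> t) \<otimes> (a \<oplus> b) = t \<otimes> (s \<otimes> a) \<oplus> s \<otimes> (t \<otimes> b)"
          using stc abc by (simp add: r_distr m_ac)
        then have "(s \<otimes> t) \<otimes> (a \<oplus> b) = \<zero>" using st stc by simp
        then show ?thesis using abc Mm[OF st(1,3)] P_iff by blast
      qed
      show "\<ominus> a \<in> P" if "a \<in> P" for a
      proof -
        have "a \<in> carrier R" using that P_iff by blast
        then show ?thesis using mult[OF that, of "\<ominus> \<one>"] by (simp add: l_minus)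
      qed
    qed
    show "y \<otimes> c \<in> P" if "c \<in> P" "y \<in> carrier R" for c y
      using mult that by blast
    show "c \<otimes> y \<in> P" if "c \<in> P" "y \<in> carrier R" for c y
      using mult[OF that] m_comm[of c y] that P_iff by auto
  qed
  then have "primeideal P R"
    by (rule primeidealI[OF _ is_cring]) (use M1 Mm P_def in auto)
  moreover have "Q = P" if Q: "primeideal Q R" "Q \<subseteq> P" for Q
  proof -
    interpret Q: primeideal Q R by (rule Q(1))
    have "\<one> \<notin> Q" using Q.I_notcarr Q.one_imp_carrier by blast
    moreover have "\<zero> \<in> Q" by simp
    ultimately have "carrier R - Q \<in> \<S>"
      unfolding \<S>_def using Q(2) Mx x(1) Q.I_prime P_def by auto
    moreover have "M \<subseteq> carrier R - Q" using Q(2) Mc P_def by blast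
    ultimately have "carrier R - Q = M" by (rule max)
    then show ?thesis unfolding P_def using Q.Icarr by blast
  qed
  ultimately have "minimal_prime R P" unfolding minimal_prime_def by blast
  then show ?thesis using Mx P_def by blast
qed

section \<open>Finitely many minimal primes give a finite colouring\<close>

lemma AG_edgeD:
  assumes "{I, J} \<in> AG_edges R"
  shows "ideal I R" "ideal J R" "\<And>x y. x \<in> I \<Longrightarrow> y \<in> J \<Longrightarrow> x \<otimes> y = \<zero>"
proof -
  obtain A B where AB: "{I, J} = {A, B}" and V: "A \<in> AG_verts R" "B \<in> AG_verts R"
    and prod: "A \<cdot> B = {\<zero>}"
    using assms unfolding AG_edges_def mem_Collect_eq by (elim exE conjE) (rule that)
  have id: "ideal A R" "ideal B R"
    using V unfolding AG_verts_def annihilating_ideal_def by auto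
  show "ideal I R" "ideal J R"
    using AB id by (auto simp: doubleton_eq_iff)
  have zero: "\<And>a b. a \<in> A \<Longrightarrow> b \<in> B \<Longrightarrow> a \<otimes> b = \<zero>"
    using prod ideal_prod_eq_zero_iff[OF id] by blast
  fix x y assume xy: "x \<in> I" "y \<in> J"
  have "x \<in> carrier R" "y \<in> carrier R"
    using xy \<open>ideal I R\<close> \<open>ideal J R\<close> by (auto intro: ideal.Icarr)
  then show "x \<otimes> y = \<zero>"
    using AB zero[of x y] zero[of y x] xy m_comm[of x y] by (auto simp: doubleton_eq_iff)
qed

text \<open>The colour of \<open>I\<close> is the number of a minimal prime \<open>p I\<close> that does not contain \<open>I\<close>. If \<open>I\<close> and
  \<open>J\<close> share the prime, then elements of \<open>I\<close> and of \<open>J\<close> outside of it have a nonzero product.\<close>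

lemma AG_colouring_if_finite_minimal_primes:
  assumes red: "reduced R" and fin: "finite {P. minimal_prime R P}"
  shows "\<exists>n c. colouring (AG_verts R) (AG_edges R) n c"
proof -
  obtain f :: "'a set \<Rightarrow> nat" and n where f: "f ` {P. minimal_prime R P} = {i. i < n}"
    and inj: "inj_on f {P. minimal_prime R P}"
    using finite_imp_inj_to_nat_seg[OF fin] by blast
  define p where "p I = (SOME P. minimal_prime R P \<and> \<not> I \<subseteq> P)" for I
  have p: "minimal_prime R (p I)" "\<not> I \<subseteq> p I" if I: "I \<in> AG_verts R" for I
  proof -
    have id: "ideal I R" and nz: "I \<noteq> {\<zero>}"
      using I unfolding AG_verts_def annihilating_ideal_def by auto
    have "\<zero> \<in> I"
      using additive_subgroup.zero_closed[OF ideal.axioms(1)[OF id]] .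
    then obtain x where x: "x \<in> I" "x \<noteq> \<zero>"
      using nz by blast
    moreover have "x \<in> carrier R"
      using ideal.Icarr[OF id x(1)] .
    ultimately have "\<exists>P. minimal_prime R P \<and> \<not> I \<subseteq> P"
      using minimal_prime_avoiding[OF red] by blast
    then have "minimal_prime R (p I) \<and> \<not> I \<subseteq> p I"
      unfolding p_def by (rule someI_ex)
    then show "minimal_prime R (p I)" "\<not> I \<subseteq> p I" by auto
  qed
  have "p I \<noteq> p J" if IJ: "I \<in> AG_verts R" "J \<in> AG_verts R" "{I, J} \<in> AG_edges R" for I J
  proof
    assume eq: "p I = p J"
    interpret P: primeideal "p I" R
      using p(1)[OF IJ(1)] unfolding minimal_prime_def by blast
    obtain x y where xy: "x \<in> I" "x \<notin> p I" "y \<in> J" "y \<notin> p I"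
      using p(2)[OF IJ(1)] p(2)[OF IJ(2)] eq by auto
    have "x \<otimes> y \<in> p I"
      using AG_edgeD(3)[OF IJ(3) xy(1,3)] by simp
    then show False
      using P.I_prime[of x y] xy AG_edgeD(1,2)[OF IJ(3)] by (meson ideal.Icarr)
  qed
  then have "colouring (AG_verts R) (AG_edges R) n (f \<circ> p)"
    unfolding colouring_def using f p(1) inj by (auto dest: inj_onD)
  then show ?thesis by blast
qed

section \<open>Orthogonal sets and prime annihilators\<close>

definition orthogonal :: "'a set \<Rightarrow> bool" where
  "orthogonal X \<longleftrightarrow> X \<subseteq> carrier R - {\<zero>} \<and> pairwise (\<lambda>x y. x \<otimes> y = \<zero>) X"

lemma PIdl_products_zero:
  assumes "x \<in> carrier R" "y \<in> carrier R" "x \<otimes> y = \<zero>" "u \<in> PIdl x" "v \<in> PIdl y"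
  shows "u \<otimes> v = \<zero>"
proof -
  obtain a b where ab: "a \<in> carrier R" "u = a \<otimes> x" "b \<in> carrier R" "v = b \<otimes> y"
    using assms(4,5) unfolding cgenideal_def by blast
  then have "u \<otimes> v = (a \<otimes> b) \<otimes> (x \<otimes> y)"
    using assms(1,2) by (simp add: m_ac)
  then show ?thesis
    using assms(3) ab by simp
qed

text \<open>Orthogonal elements generate distinct ideals because a common multiple of two of them would
  have square zero.\<close>

lemma infinite_clique_if_infinite_orthogonal:
  assumes red: "reduced R" and X: "orthogonal X" "infinite X"
  shows "\<exists>K \<subseteq> AG_verts R. infinite K \<and> clique K (AG_edges R)"
proof -
  have carr: "x \<in> carrier R" "x \<noteq> \<zero>" if "x \<in> X" for x
    using that X(1) unfolding orthogonal_def by auto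
  have orth: "x \<otimes> y = \<zero>" if "x \<in> X" "y \<in> X" "x \<noteq> y" for x y
    using that X(1) unfolding orthogonal_def pairwise_def by auto
  have inj: "inj_on (\<lambda>x. PIdl x) X"
  proof (rule inj_onI, rule ccontr)
    fix x y assume xy: "x \<in> X" "y \<in> X" "PIdl x = PIdl y" "x \<noteq> y"
    have "x \<in> PIdl x" "x \<in> PIdl y"
      using cgenideal_self carr(1)[OF xy(1)] xy(3) by auto
    then have "x \<otimes> x = \<zero>"
      using PIdl_products_zero carr(1)[OF xy(1)] carr(1)[OF xy(2)] orth[OF xy(1,2,4)] by blast
    then show False
      using reduced_square_nonzero[OF red] carr xy(1) by blast
  qed
  have vert: "PIdl x \<in> AG_verts R" if x: "x \<in> X" for x
  proof -
    have "infinite (X - {x})" using X(2) by simp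
    then obtain y where y: "y \<in> X" "y \<noteq> x"
      using infinite_imp_nonempty by blast
    have "y \<in> Ann R (PIdl x)"
      unfolding Ann_def using PIdl_products_zero[OF carr(1)[OF y(1)] carr(1)[OF x] orth[OF y(1) x y(2)]]
        cgenideal_self carr(1)[OF y(1)] by blast
    then have "Ann R (PIdl x) \<noteq> {\<zero>}"
      using carr(2)[OF y(1)] by blast
    moreover have "PIdl x \<noteq> {\<zero>}"
      using cgenideal_self[OF carr(1)[OF x]] carr(2)[OF x] by blast
    ultimately show ?thesis
      unfolding AG_verts_def annihilating_ideal_def using cgenideal_ideal[OF carr(1)[OF x]] by blast
  qed
  have "{PIdl x, PIdl y} \<in> AG_edges R" if xy: "x \<in> X" "y \<in> X" "PIdl x \<noteq> PIdl y" for x y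
  proof -
    have "x \<noteq> y" using xy(3) by blast
    then have "\<forall>u\<in>PIdl x. \<forall>v\<in>PIdl y. u \<otimes> v = \<zero>"
      using PIdl_products_zero[OF carr(1)[OF xy(1)] carr(1)[OF xy(2)] orth[OF xy(1,2)]] by blast
    then have "(PIdl x) \<cdot> (PIdl y) = {\<zero>}"
      using ideal_prod_eq_zero_iff cgenideal_ideal carr(1) xy(1,2) by simp
    then show ?thesis
      unfolding AG_edges_def using vert xy by blast
  qed
  then have "clique ((\<lambda>x. PIdl x) ` X) (AG_edges R)"
    unfolding clique_def by blast
  moreover have "infinite ((\<lambda>x. PIdl x) ` X)"
    using X(2) inj finite_image_iff by blast
  ultimately show ?thesis
    using vert by blast
qed

definition prime_annihilator :: "'a \<Rightarrow> bool" where
  "prime_annihilator z \<longleftrightarrow> z \<in> carrier R \<and> primeideal (Ann R {z}) R"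

lemma prime_annihilator_nonzero:
  assumes "prime_annihilator z"
  shows "z \<noteq> \<zero>"
proof
  assume "z = \<zero>"
  then have "Ann R {z} = carrier R" unfolding Ann_def by auto
  then show False
    using assms primeideal.I_notcarr unfolding prime_annihilator_def by blast
qed

text \<open>If \<open>Ann(z)\<close> is not prime, a failing pair \<open>a b \<in> Ann(z)\<close> provides the two orthogonal multiples
  \<open>a z\<close> and \<open>b z\<close> of \<open>z\<close>.\<close>

lemma orthogonal_multiples_if_not_prime_annihilator:
  assumes z: "z \<in> carrier R" "z \<noteq> \<zero>" "\<not> prime_annihilator z"
  shows "\<exists>u\<in>PIdl z. \<exists>v\<in>PIdl z. u \<noteq> \<zero> \<and> v \<noteq> \<zero> \<and> u \<otimes> v = \<zero>"
proof -
  have "\<one> \<notin> Ann R {z}" using z(1,2) unfolding Ann_def by simp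
  then have proper: "carrier R \<noteq> Ann R {z}" by blast
  have "\<not> (\<forall>a\<in>carrier R. \<forall>b\<in>carrier R. a \<otimes> b \<in> Ann R {z} \<longrightarrow> a \<in> Ann R {z} \<or> b \<in> Ann R {z})"
    using primeidealI[OF Ann_ideal[OF z(1)] is_cring proper] z(1,3)
    unfolding prime_annihilator_def by blast
  then obtain a b where ab: "a \<in> carrier R" "b \<in> carrier R" "a \<otimes> b \<otimes> z = \<zero>"
    "a \<otimes> z \<noteq> \<zero>" "b \<otimes> z \<noteq> \<zero>"
    unfolding Ann_def by auto
  have "(a \<otimes> z) \<otimes> (b \<otimes> z) = (a \<otimes> b \<otimes> z) \<otimes> z"
    using ab(1,2) z(1) by (simp add: m_ac)
  then have "(a \<otimes> z) \<otimes> (b \<otimes> z) = \<zero>" using ab(3) z(1) by simp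
  then show ?thesis
    using ab unfolding cgenideal_def by blast
qed

lemma PIdl_mono:
  assumes "y \<in> carrier R" "x \<in> PIdl y"
  shows "x \<in> carrier R" "PIdl x \<subseteq> PIdl y"
proof -
  show "x \<in> carrier R"
    using ideal.Icarr[OF cgenideal_ideal[OF assms(1)] assms(2)] .
  show "PIdl x \<subseteq> PIdl y"
    using cgenideal_minimal[OF cgenideal_ideal[OF assms(1)] assms(2)] .
qed

text \<open>If no multiple of \<open>y\<close> has a prime annihilator, splitting never stops. The state is a pair
  \<open>(u, v)\<close> of nonzero elements with \<open>u v = 0\<close> and \<open>v\<close> a multiple of \<open>y\<close>; here \<open>u\<close> is kept and the
  next pair is taken from the multiples of \<open>v\<close>. All elements kept later are multiples of \<open>v\<close> and
  hence orthogonal to \<open>u\<close>.\<close>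

lemma prime_annihilator_multiple_exists:
  assumes red: "reduced R" and fin: "\<And>X. orthogonal X \<Longrightarrow> finite X"
    and y: "y \<in> carrier R" "y \<noteq> \<zero>"
  shows "\<exists>z\<in>PIdl y. prime_annihilator z"
proof (rule ccontr)
  assume none: "\<not> (\<exists>z\<in>PIdl y. prime_annihilator z)"
  define good where "good p \<longleftrightarrow> fst p \<in> carrier R \<and> fst p \<noteq> \<zero> \<and> snd p \<in> PIdl y \<and> snd p \<noteq> \<zero>
    \<and> fst p \<otimes> snd p = \<zero>" for p
  have split: "\<exists>q. good q \<and> fst q \<in> PIdl v \<and> snd q \<in> PIdl v" if v: "v \<in> PIdl y" "v \<noteq> \<zero>" for v
  proof -
    have vc: "v \<in> carrier R" "PIdl v \<subseteq> PIdl y" using PIdl_mono[OF y(1) v(1)] .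
    obtain s t where "s \<in> PIdl v" "t \<in> PIdl v" "s \<noteq> \<zero>" "t \<noteq> \<zero>" "s \<otimes> t = \<zero>"
      using orthogonal_multiples_if_not_prime_annihilator[OF vc(1) v(2)] none v(1) by blast
    then have "good (s, t) \<and> fst (s, t) \<in> PIdl v \<and> snd (s, t) \<in> PIdl v"
      unfolding good_def using vc PIdl_mono(1) by auto
    then show ?thesis by blast
  qed
  have "\<exists>p. \<forall>n::nat. good (p n) \<and> fst (p (Suc n)) \<in> PIdl (snd (p n)) \<and> snd (p (Suc n)) \<in> PIdl (snd (p n))"
  proof (rule dependent_nat_choice)
    show "\<exists>q. good q" using split[OF cgenideal_self[OF y(1)] y(2)] by blast
    show "\<exists>r. good r \<and> fst r \<in> PIdl (snd q) \<and> snd r \<in> PIdl (snd q)" if "good q" for q and n :: nat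
      using split that unfolding good_def by blast
  qed
  then obtain p where p: "\<And>n::nat. good (p n)" "\<And>n. fst (p (Suc n)) \<in> PIdl (snd (p n))"
    "\<And>n. snd (p (Suc n)) \<in> PIdl (snd (p n))"
    by blast
  have sc: "snd (p n) \<in> carrier R" for n
    using p(1)[of n] PIdl_mono(1)[OF y(1)] unfolding good_def by blast
  have nested: "snd (p (m + k)) \<in> PIdl (snd (p m))" for m k
  proof (induction k)
    case 0
    then show ?case using cgenideal_self[OF sc] by simp
  next
    case (Suc k)
    then show ?case using p(3)[of "m + k"] PIdl_mono(2)[OF sc Suc.IH] by auto
  qed
  have later: "fst (p m) \<otimes> fst (p n) = \<zero>" if "m < n" for m n
  proof -
    obtain k where n: "n = Suc (m + k)" using less_imp_Suc_add[OF \<open>m < n\<close>] by blast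
    have "fst (p n) \<in> PIdl (snd (p m))"
      unfolding n using p(2)[of "m + k"] PIdl_mono(2)[OF sc nested] by blast
    then show ?thesis
      using PIdl_products_zero[of "fst (p m)" "snd (p m)"] cgenideal_self p(1)[of m] sc
      unfolding good_def by blast
  qed
  have fc: "fst (p n) \<in> carrier R" "fst (p n) \<noteq> \<zero>" for n
    using p(1)[of n] unfolding good_def by auto
  have orth: "fst (p m) \<otimes> fst (p n) = \<zero>" if "m \<noteq> n" for m n
    using that later[of m n] later[of n m] m_comm[OF fc(1) fc(1)] by (cases m n rule: linorder_cases) auto
  have "inj (\<lambda>n. fst (p n))"
  proof (rule injI, rule ccontr)
    fix m n assume "fst (p m) = fst (p n)" "m \<noteq> n"
    then have "fst (p m) \<otimes> fst (p m) = \<zero>" using orth[of m n] by simp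
    then show False using reduced_square_nonzero[OF red fc] by blast
  qed
  then have "infinite (range (\<lambda>n. fst (p n)))"
    by (simp add: finite_image_iff)
  moreover have "orthogonal (range (\<lambda>n. fst (p n)))"
    unfolding orthogonal_def
  proof (intro conjI pairwiseI)
    show "range (\<lambda>n. fst (p n)) \<subseteq> carrier R - {\<zero>}" using fc by auto
    show "x \<otimes> x' = \<zero>"
      if "x \<in> range (\<lambda>n. fst (p n))" "x' \<in> range (\<lambda>n. fst (p n))" "x \<noteq> x'" for x x'
      using that by (auto intro!: orth)
  qed
  ultimately show False
    using fin by blast
qed

text \<open>If \<open>a z w = 0\<close>, then \<open>a w\<close> lies in the prime \<open>Ann(z)\<close>, but \<open>w\<close> does not because \<open>z w \<noteq> 0\<close>;
  so \<open>a\<close> does.\<close>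

lemma Ann_mult_prime_annihilator:
  assumes z: "prime_annihilator z" and w: "w \<in> carrier R" "z \<otimes> w \<noteq> \<zero>"
  shows "Ann R {z \<otimes> w} = Ann R {z}"
proof -
  interpret P: primeideal "Ann R {z}" R
    using z unfolding prime_annihilator_def by blast
  have zc: "z \<in> carrier R" using z unfolding prime_annihilator_def by blast
  have wn: "w \<notin> Ann R {z}" using w zc m_comm[of w z] unfolding Ann_def by auto
  show ?thesis
  proof
    show "Ann R {z} \<subseteq> Ann R {z \<otimes> w}"
      unfolding Ann_def using zc w(1) by (auto simp: m_assoc[symmetric])
    show "Ann R {z \<otimes> w} \<subseteq> Ann R {z}"
    proof
      fix a assume a: "a \<in> Ann R {z \<otimes> w}"
      then have "a \<in> carrier R" "a \<otimes> w \<in> Ann R {z}"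
        unfolding Ann_def using zc w(1) by (auto simp: m_ac)
      then show "a \<in> Ann R {z}" using P.I_prime[of a w] w(1) wn by blast
    qed
  qed
qed

text \<open>One element chosen for each prime annihilator gives an orthogonal set: by the preceding lemma,
  two chosen elements with nonzero product \<open>z w\<close> would have the same annihilator
  \<open>Ann(z w)\<close>.\<close>

lemma finite_prime_annihilators:
  assumes fin: "\<And>X. orthogonal X \<Longrightarrow> finite X"
  shows "finite {Ann R {z} | z. prime_annihilator z}"
proof -
  define \<A> where "\<A> = {Ann R {z} | z. prime_annihilator z}"
  define g where "g A = (SOME z. prime_annihilator z \<and> Ann R {z} = A)" for A
  have g: "prime_annihilator (g A)" "Ann R {g A} = A" if "A \<in> \<A>" for A
  proof -
    have "\<exists>z. prime_annihilator z \<and> Ann R {z} = A" using that unfolding \<A>_def by blast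
    then have "prime_annihilator (g A) \<and> Ann R {g A} = A" unfolding g_def by (rule someI_ex)
    then show "prime_annihilator (g A)" "Ann R {g A} = A" by auto
  qed
  have gc: "g A \<in> carrier R" if "A \<in> \<A>" for A
    using g(1)[OF that] unfolding prime_annihilator_def by blast
  have orth: "g A \<otimes> g B = \<zero>" if AB: "A \<in> \<A>" "B \<in> \<A>" "A \<noteq> B" for A B
  proof (rule ccontr)
    assume ne: "g A \<otimes> g B \<noteq> \<zero>"
    have "Ann R {g A \<otimes> g B} = A"
      using Ann_mult_prime_annihilator[OF g(1)[OF AB(1)] gc[OF AB(2)] ne] g(2)[OF AB(1)] by simp
    moreover have "Ann R {g A \<otimes> g B} = B"
      using Ann_mult_prime_annihilator[OF g(1)[OF AB(2)] gc[OF AB(1)]] g(2)[OF AB(2)] ne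
        m_comm[OF gc[OF AB(1)] gc[OF AB(2)]] by simp
    ultimately show False using AB(3) by blast
  qed
  have g_orth: "orthogonal (g ` \<A>)"
    unfolding orthogonal_def
  proof (intro conjI pairwiseI)
    show "g ` \<A> \<subseteq> carrier R - {\<zero>}"
      using gc prime_annihilator_nonzero[OF g(1)] by auto
    show "x \<otimes> y = \<zero>" if "x \<in> g ` \<A>" "y \<in> g ` \<A>" "x \<noteq> y" for x y
      using that orth by auto
  qed
  have "inj_on g \<A>"
    by (rule inj_on_inverseI[of _ "\<lambda>z. Ann R {z}"]) (rule g(2))
  then have "finite \<A>"
    using fin[OF g_orth] by (simp add: finite_image_iff)
  then show ?thesis unfolding \<A>_def .
qed

section \<open>Minimal primes are prime annihilators\<close>

text \<open>Otherwise pick from each ideal an element outside \<open>P\<close>; their product lies in all the ideals but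
  not in the prime \<open>P\<close>. Intersecting with \<open>carrier R\<close> keeps the empty intersection inside the
  ring.\<close>

lemma prime_contains_finite_intersection:
  assumes P: "primeideal P R" and fin: "finite \<A>" and id: "\<And>A. A \<in> \<A> \<Longrightarrow> ideal A R"
    and inter: "carrier R \<inter> \<Inter>\<A> \<subseteq> P"
  shows "\<exists>A\<in>\<A>. A \<subseteq> P"
proof (rule ccontr)
  assume none: "\<not> (\<exists>A\<in>\<A>. A \<subseteq> P)"
  interpret P: primeideal P R by (rule P)
  have "\<exists>x\<in>carrier R. x \<notin> P \<and> (\<forall>A\<in>\<B>. x \<in> A)" if "finite \<B>" "\<B> \<subseteq> \<A>" for \<B>
    using that
  proof (induction \<B>)
    case empty
    then show ?case using P.I_notcarr P.Icarr by blast
  next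
    case (insert A \<B>)
    then obtain x where x: "x \<in> carrier R" "x \<notin> P" "\<forall>B\<in>\<B>. x \<in> B" by blast
    obtain a where a: "a \<in> A" "a \<notin> P" using none insert.prems by blast
    have ac: "a \<in> carrier R" using a(1) id insert.prems by (meson ideal.Icarr insert_subset)
    have "a \<otimes> x \<notin> P" using P.I_prime[OF ac x(1)] a(2) x(2) by blast
    moreover have "a \<otimes> x \<in> A"
      using a(1) x(1) id insert.prems by (meson ideal.I_r_closed insert_subset)
    moreover have "\<forall>B\<in>\<B>. a \<otimes> x \<in> B"
      using x(3) ac id insert.prems by (meson ideal.I_l_closed insert_subset subsetD)
    ultimately show ?case using ac x(1) by auto
  qed
  from this[OF fin] show False using inter by blast
qed

text \<open>The prime annihilators form a finite set of primes with zero intersection, and every such set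
  contains all minimal primes.\<close>

lemma finite_minimal_primes_if_finite_orthogonal_sets:
  assumes red: "reduced R" and fin: "\<And>X. orthogonal X \<Longrightarrow> finite X"
  shows "finite {P. minimal_prime R P}"
proof -
  define \<A> where "\<A> = {Ann R {z} | z. prime_annihilator z}"
  have prime: "primeideal A R" if "A \<in> \<A>" for A
    using that unfolding \<A>_def prime_annihilator_def by blast
  have zero: "y = \<zero>" if y: "y \<in> carrier R" "y \<in> \<Inter>\<A>" for y
  proof (rule ccontr)
    assume "y \<noteq> \<zero>"
    then obtain z where z: "z \<in> PIdl y" "prime_annihilator z"
      using prime_annihilator_multiple_exists[OF red fin y(1)] by blast
    have zc: "z \<in> carrier R" using PIdl_mono(1)[OF y(1) z(1)] .
    have "y \<otimes> z = \<zero>" using y(2) z(2) unfolding \<A>_def Ann_def by blast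
    \<comment> \<open>As \<open>z\<close> is a multiple of \<open>y\<close>, its square is a multiple of \<open>y z\<close>.\<close>
    moreover obtain a where "a \<in> carrier R" "z = a \<otimes> y" using z(1) unfolding cgenideal_def by blast
    ultimately have "z \<otimes> z = \<zero>"
      using m_assoc[of a y z] y(1) zc by simp
    then show False
      using reduced_square_nonzero[OF red zc] prime_annihilator_nonzero[OF z(2)] by blast
  qed
  have "P \<in> \<A>" if P: "minimal_prime R P" for P
  proof -
    interpret P: primeideal P R using P unfolding minimal_prime_def by blast
    have "carrier R \<inter> \<Inter>\<A> \<subseteq> P" using zero P.zero_closed by blast
    then obtain A where A: "A \<in> \<A>" "A \<subseteq> P"
      using prime_contains_finite_intersection[OF P.primeideal, of \<A>] finite_prime_annihilators[OF fin]
        prime primeideal.axioms(1) unfolding \<A>_def by blast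
    then show ?thesis using P prime unfolding minimal_prime_def by blast
  qed
  then have "{P. minimal_prime R P} \<subseteq> \<A>" by blast
  moreover have "finite \<A>"
    unfolding \<A>_def using fin by (rule finite_prime_annihilators)
  ultimately show ?thesis by (rule finite_subset)
qed

end

section \<open>The equivalence\<close>

theorem theorem2p10:
  fixes R :: "('a, 'b) ring_scheme"
  assumes "cring R" and "reduced R"
  shows "(chromatic_number (AG_verts R) (AG_edges R) < \<infinity> \<longleftrightarrow>
            clique_number (AG_verts R) (AG_edges R) < \<infinity>)
       \<and> (clique_number (AG_verts R) (AG_edges R) < \<infinity> \<longleftrightarrow>
            \<not> (\<exists>K \<subseteq> AG_verts R. infinite K \<and> clique K (AG_edges R)))
       \<and> (\<not> (\<exists>K \<subseteq> AG_verts R. infinite K \<and> clique K (AG_edges R)) \<longleftrightarrow>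
            finite {P. minimal_prime R P})"
proof -
  interpret cring R by (rule assms(1))
  let ?V = "AG_verts R" and ?E = "AG_edges R"
  have "clique_number ?V ?E < \<infinity>" if "chromatic_number ?V ?E < \<infinity>"
    using that clique_number_finite_if_colouring unfolding chromatic_number_finite_iff by blast
  moreover have "\<not> (\<exists>K \<subseteq> ?V. infinite K \<and> clique K ?E)" if "clique_number ?V ?E < \<infinity>"
    using no_infinite_clique_if_clique_number_finite[OF that] by blast
  moreover have "finite {P. minimal_prime R P}" if "\<not> (\<exists>K \<subseteq> ?V. infinite K \<and> clique K ?E)"
    using finite_minimal_primes_if_finite_orthogonal_sets[OF assms(2)]
      infinite_clique_if_infinite_orthogonal[OF assms(2)] that by blast
  moreover have "chromatic_number ?V ?E < \<infinity>" if "finite {P. minimal_prime R P}"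
    using AG_colouring_if_finite_minimal_primes[OF assms(2) that]
    unfolding chromatic_number_finite_iff .
  ultimately show ?thesis by blast
qed

end
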